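(* Let $\ell > m > 0$ be integers with $\gcd(\ell,m)=1$, let $n \geq 1$ be an integer, and let $$X_n(t) := t^n - \sum_{k=1}^{n} \binom{n}{k} t^{n-k} (\ell-m) Q_k(\ell,m).$$ If there is a prime $p$ such that $p \mid (\ell-m)$, $p^2 \nmid (\ell-m)$, and $p \nmid n$, then $X_n$ is irreducible over $\mathbb{Z}$.
   Context: For integers $a \neq b$ and $k \ge 1$, $Q_k(a,b) := \frac{a^k - b^k}{a-b} = \sum_{i=0}^{k-1} a^{k-1-i} b^i$. A polynomial $f \in \mathbb{Z}[t]$ is called reducible (over $\mathbb{Z}$) if $f = gh$ with $g,h \in \mathbb{Z}[t]$ both of positive degree; otherwise it is called irreducible (over $\mathbb{Z}$). *)

theory Defs
  imports "HOL-Computational_Algebra.Computational_Algebra"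
begin

text \<open>Meaningful for \<open>a \<noteq> b\<close> and \<open>k \<ge> 1\<close>; the integer division is exact, see the two lemmas below.\<close>

definition Q :: "nat \<Rightarrow> int \<Rightarrow> int \<Rightarrow> int" where
  "Q k a b = (a ^ k - b ^ k) div (a - b)"

lemma Q_eq_sum:
  assumes "a \<noteq> b"
  shows "Q k a b = (\<Sum>i<k. a ^ (k - 1 - i) * b ^ i)"
proof -
  have "a ^ k - b ^ k = (a - b) * (\<Sum>i<k. a ^ (k - Suc i) * b ^ i)"
    using power_diff_sumr2[of b k a] by (simp add: left_diff_distrib)
  then show ?thesis
    using assms by (simp add: Q_def)
qed

lemma diff_mult_Q: "(a - b) * Q k a b = a ^ k - b ^ k"
  by (simp add: Q_def power_diff_sumr2)

definition X :: "int \<Rightarrow> int \<Rightarrow> nat \<Rightarrow> int poly" where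
  "X l m n = monom 1 n - (\<Sum>k = 1..n. monom (int (n choose k) * ((l - m) * Q k l m)) (n - k))"

text \<open>
  This is not the ring-theoretic \<open>irreducible\<close>: constant factors are disregarded, so
  \<open>[:2, 2:]\<close> counts as irreducible here, and so do constants.
\<close>

definition reducible_over_Z :: "int poly \<Rightarrow> bool" where
  "reducible_over_Z f \<longleftrightarrow> (\<exists>g h. f = g * h \<and> degree g > 0 \<and> degree h > 0)"

definition irreducible_over_Z :: "int poly \<Rightarrow> bool" where
  "irreducible_over_Z f \<longleftrightarrow> \<not> reducible_over_Z f"

end

theory Submission
  imports Defs "HOL-Number_Theory.Cong"
begin

text \<open>
  Eisenstein's criterion applies at \<open>p\<close>: every coefficient of \<open>X l m n\<close> except the leading one is
  divisible by \<open>l - m\<close>, and the constant one is \<open>-(l - m) * Q n l m\<close> with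
  \<open>Q n l m \<equiv> n * m ^ (n - 1)\<close> modulo \<open>p\<close>.
\<close>

text \<open>Modulo \<open>p\<close>, the lowest surviving term of \<open>g\<close> times the
  constant term of \<open>h\<close> gives a surviving coefficient of \<open>g * h\<close> at the
  same index. By \<open>low\<close> that index is at least the degree of the product, so
  \<open>g\<close> alone already has full degree.\<close>

lemma eisenstein_aux:
  fixes p :: "'a :: idom"
  assumes p: "prime_elem p"
    and lead: "\<not> p dvd lead_coeff (g * h)"
    and low: "\<And>i. i < degree (g * h) \<Longrightarrow> p dvd coeff (g * h) i"
    and h0: "\<not> p dvd coeff h 0"
  shows "degree h = 0"
proof -
  have "\<not> p dvd lead_coeff g"
    using lead by (auto simp: lead_coeff_mult)
  \<comment> \<open>Such an index exists: \<open>degree g\<close> is one.\<close>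
  define i where "i = (LEAST i. \<not> p dvd coeff g i)"
  have gi: "\<not> p dvd coeff g i"
    unfolding i_def by (rule LeastI) fact
  have "p dvd coeff g j" if "j < i" for j
    using not_less_Least that unfolding i_def by blast
  then have "p dvd (\<Sum>j<i. coeff g j * coeff h (i - j))"
    by (intro dvd_sum) auto
  moreover have "coeff (g * h) i = (\<Sum>j<i. coeff g j * coeff h (i - j)) + coeff g i * coeff h 0"
    by (simp add: coeff_mult flip: lessThan_Suc_atMost)
  moreover have "\<not> p dvd coeff g i * coeff h 0"
    using p gi h0 by (simp add: prime_elem_dvd_mult_iff)
  ultimately have "\<not> p dvd coeff (g * h) i"
    by (simp add: dvd_add_right_iff)
  then have "degree (g * h) \<le> i"
    using low not_less by blast
  also have "i \<le> degree g"
    using gi by (intro le_degree) auto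
  finally have "degree (g * h) \<le> degree g" .
  moreover have "g \<noteq> 0" "h \<noteq> 0"
    using lead by auto
  ultimately show ?thesis
    by (simp add: degree_mult_eq)
qed

text \<open>The constant coefficient of \<open>g * h\<close> is the product of those of
  \<open>g\<close> and \<open>h\<close>, so \<open>p\<close> fails to divide one of them, and
  \<open>eisenstein_aux\<close> forces that factor to be constant.\<close>

lemma eisenstein_criterion:
  fixes p :: "'a :: idom"
  assumes p: "prime_elem p"
    and lead: "\<not> p dvd lead_coeff (g * h)"
    and low: "\<And>i. i < degree (g * h) \<Longrightarrow> p dvd coeff (g * h) i"
    and const: "\<not> p ^ 2 dvd coeff (g * h) 0"
  shows "degree g = 0 \<or> degree h = 0"
proof -
  have "\<not> p dvd coeff g 0 \<or> \<not> p dvd coeff h 0"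
    using const mult_dvd_mono[of p "coeff g 0" p "coeff h 0"]
    by (auto simp: coeff_mult power2_eq_square)
  then show ?thesis
    using eisenstein_aux[OF p, of g h] eisenstein_aux[OF p, of h g] lead low
    by (auto simp: mult.commute)
qed

text \<open>Only the summand with \<open>k = n - i\<close> reaches coefficient \<open>i\<close>, and
  this \<open>k\<close> lies in \<open>1..n\<close> exactly when \<open>i < n\<close>.\<close>

lemma coeff_X:
  "coeff (X l m n) i =
     (if i = n then 1 else 0) - (if i < n then int (n choose i) * (l ^ (n - i) - m ^ (n - i)) else 0)"
proof -
  have "coeff (\<Sum>k = 1..n. monom (int (n choose k) * ((l - m) * Q k l m)) (n - k)) i =
      (\<Sum>k = 1..n. if k = n - i \<and> i < n then int (n choose k) * (l ^ k - m ^ k) else 0)"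
    unfolding coeff_sum by (intro sum.cong) (auto simp: diff_mult_Q)
  also have "\<dots> = (if i < n then int (n choose i) * (l ^ (n - i) - m ^ (n - i)) else 0)"
    by (auto simp: binomial_symmetric[of i n])
  finally show ?thesis
    by (auto simp: X_def)
qed

lemma degree_X: "degree (X l m n) = n"
  by (rule antisym) (auto intro!: degree_le le_degree simp: coeff_X)

text \<open>Replacing \<open>a\<close> by \<open>b\<close> modulo \<open>p\<close> turns each of the
  \<open>k\<close> terms of the sum formula into \<open>b ^ (k - 1)\<close>.\<close>

lemma cong_Q:
  assumes "p dvd a - b" "a \<noteq> b"
  shows "[Q k a b = int k * b ^ (k - 1)] (mod p)"
proof -
  have ab: "[a = b] (mod p)"
    using assms by (simp add: cong_iff_dvd_diff)
  have "[Q k a b = (\<Sum>i<k. b ^ (k - 1 - i) * b ^ i)] (mod p)"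
    unfolding Q_eq_sum[OF \<open>a \<noteq> b\<close>] by (intro cong_sum cong_mult cong_pow ab cong_refl)
  also have "(\<Sum>i<k. b ^ (k - 1 - i) * b ^ i) = (\<Sum>i<k. b ^ (k - 1))"
    by (intro sum.cong) (auto simp flip: power_add)
  finally show ?thesis
    by simp
qed

theorem theorem9:
  fixes l m :: int and n :: nat
  assumes "l > m" and "m > 0" and "gcd l m = 1" and "n \<ge> 1"
    and "\<exists>p::int. prime p \<and> p dvd (l - m) \<and> \<not> p ^ 2 dvd (l - m) \<and> \<not> p dvd int n"
  shows "irreducible_over_Z (X l m n)"
proof -
  obtain p :: int where p: "prime p" "p dvd l - m" "\<not> p ^ 2 dvd l - m" "\<not> p dvd int n"
    using assms(5) by blast
  \<comment> \<open>This is where coprimality enters: a common divisor of \<open>l - m\<close> and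
    \<open>m\<close> also divides \<open>l\<close>.\<close>
  have "\<not> p dvd m"
  proof
    assume "p dvd m"
    moreover from this have "p dvd l"
      using p(2) by (simp add: dvd_diff_left_iff)
    ultimately have "p dvd gcd l m"
      by simp
    then show False
      using p(1) \<open>gcd l m = 1\<close> by auto
  qed
  then have "\<not> p dvd int n * m ^ (n - 1)"
    using p(1,4) by (auto simp: prime_dvd_mult_iff dest: prime_dvd_power)
  then have "\<not> p dvd Q n l m"
    using cong_Q[OF p(2)] \<open>l > m\<close> cong_dvd_iff by blast
  have const: "\<not> p ^ 2 dvd coeff (X l m n) 0"
  proof
    assume "p ^ 2 dvd coeff (X l m n) 0"
    then have "p ^ 2 dvd (l - m) * Q n l m"
      \<comment> \<open>As \<open>n \<ge> 1\<close>, index 0 is not the leading one, so the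
        coefficient is \<open>-(l ^ n - m ^ n)\<close>; only the sign has to be removed.\<close>
      using \<open>n \<ge> 1\<close> dvd_minus_iff[of "p ^ 2" "l ^ n - m ^ n"]
      by (simp add: coeff_X diff_mult_Q)
    moreover have "coprime (p ^ 2) (Q n l m)"
      using p(1) \<open>\<not> p dvd Q n l m\<close> by (simp add: prime_imp_coprime)
    ultimately show False
      using p(3) by (simp add: coprime_dvd_mult_left_iff)
  qed
  have low: "p dvd coeff (X l m n) i" if "i < degree (X l m n)" for i
    \<comment> \<open>Reading \<open>diff_mult_Q\<close> backwards exposes the factor
      \<open>l - m\<close> in each difference of powers.\<close>
    using that p(2) by (simp add: degree_X coeff_X flip: diff_mult_Q)
  have lead: "\<not> p dvd lead_coeff (X l m n)"
    using prime_gt_1_int[OF p(1)] by (simp add: degree_X coeff_X)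
  have "degree g = 0 \<or> degree h = 0" if "X l m n = g * h" for g h
    using eisenstein_criterion[of p g h] p(1) lead low const unfolding that by auto
  then show ?thesis
    unfolding irreducible_over_Z_def reducible_over_Z_def by auto
qed

end
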